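(* Let $\Lambda=\{\lambda_n\}_{n=1}^{\infty}\subset\mathbb{N}$ be a strictly increasing sequence of positive integers such that $\sum_{n=1}^{\infty}\frac{1}{\lambda_n}<\infty$ and $\inf_{n}(\lambda_{n+1}-\lambda_n)>0$. Let $\overline{M_\Lambda}$ be the closed span of $M_\Lambda=\{t^{\lambda_n}\}_{n=1}^\infty$ in $L^2(0,1)$, and let $r_\Lambda=\{r_n\}_{n=1}^\infty$ be the unique biorthogonal family of $M_\Lambda$ in $\overline{M_\Lambda}$. Let $f$ be an analytic function in the unit disk $\mathbb{D}$. Then $$f\in H^2(\mathbb{D},\Lambda)$$ if and only if $$f\in\overline{M_\Lambda}\qquad\text{and}\qquad\sum_{n=1}^{\infty}\left|\langle f,r_n\rangle\right|^2<\infty.$$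
   Context: $L^2(0,1)$ is the complex Hilbert space with inner product $\langle f,g\rangle=\int_0^1 f(t)\overline{g(t)}\,dt$. Write $e_n(t)=t^{\lambda_n}$. Under the stated hypotheses on $\Lambda$ the system $\{e_n\}$ is minimal in $L^2(0,1)$ (no $e_n$ belongs to the closed span of the others), so there is a unique family $\{r_n\}_{n=1}^\infty\subset\overline{M_\Lambda}$ biorthogonal to it, i.e. $\langle e_n,r_m\rangle=1$ if $m=n$ and $0$ if $m\neq n$. $\mathbb{D}=\{z\in\mathbb{C}:|z|<1\}$ and $H^2(\mathbb{D})$ is the classical Hardy space: an analytic function $f(z)=\sum_{n=0}^\infty a_nz^n$ in $\mathbb{D}$ belongs to $H^2(\mathbb{D})$ if and only if $\sum_{n=0}^\infty|a_n|^2<\infty$, and the $a_n$ are then the Fourier coefficients of the boundary function $f(e^{i\theta})$. The subspace $H^2(\mathbb{D},\Lambda)$ consists of all $f\in H^2(\mathbb{D})$ whose coefficients $a_n$ vanish whenever $n\notin\Lambda$, i.e. those of the form $f(z)=\sum_{n=1}^{\infty}c_{\lambda_n}z^{\lambda_n}$. For $f$ analytic in $\mathbb{D}$, "$f\in\overline{M_\Lambda}$" and $\langle f,r_n\rangle$ refer to the restriction of $f$ to the interval $(0,1)$. *)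

theory Defs
  imports "HOL-Complex_Analysis.Complex_Analysis"
begin

text \<open>
  Elements of \<open>L\<^sup>2(0,1)\<close> are represented by functions rather than by classes modulo
  almost-everywhere equality: inner products, norms and membership in a closed span
  are unchanged when functions are modified on a null set.
\<close>

abbreviation unit_interval_measure :: "real measure" where
  "unit_interval_measure \<equiv> lebesgue_on {0<..<1}"

definition L2_01 :: "(real \<Rightarrow> complex) set" where
  "L2_01 = {f. f \<in> borel_measurable unit_interval_measure \<and>
               integrable unit_interval_measure (\<lambda>t. (cmod (f t))\<^sup>2)}"

definition L2_inner :: "(real \<Rightarrow> complex) \<Rightarrow> (real \<Rightarrow> complex) \<Rightarrow> complex" where
  "L2_inner f g = (\<integral>t. f t * cnj (g t) \<partial>unit_interval_measure)"

definition L2_norm :: "(real \<Rightarrow> complex) \<Rightarrow> real" where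
  "L2_norm f = sqrt (\<integral>t. (cmod (f t))\<^sup>2 \<partial>unit_interval_measure)"

definition linear_span :: "(real \<Rightarrow> complex) set \<Rightarrow> (real \<Rightarrow> complex) set" where
  "linear_span S = {p. \<exists>F c. finite F \<and> F \<subseteq> S \<and> p = (\<lambda>t. \<Sum>e\<in>F. c e * e t)}"

definition L2_closed_span :: "(real \<Rightarrow> complex) set \<Rightarrow> (real \<Rightarrow> complex) set" where
  "L2_closed_span S =
     {f \<in> L2_01. \<forall>\<epsilon>>0. \<exists>p \<in> linear_span S. L2_norm (\<lambda>t. f t - p t) < \<epsilon>}"

text \<open>The system \<open>M\<^sub>\<Lambda>\<close>, with the sequence indexed from \<open>0\<close>.\<close>

definition power_fun :: "nat \<Rightarrow> real \<Rightarrow> complex" where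
  "power_fun k t = complex_of_real (t ^ k)"

definition M_sys :: "(nat \<Rightarrow> nat) \<Rightarrow> (real \<Rightarrow> complex) set" where
  "M_sys lam = range (\<lambda>n. power_fun (lam n))"

definition biorthogonal_family :: "(nat \<Rightarrow> nat) \<Rightarrow> (nat \<Rightarrow> real \<Rightarrow> complex) \<Rightarrow> bool" where
  "biorthogonal_family lam r \<longleftrightarrow>
     (\<forall>m. r m \<in> L2_closed_span (M_sys lam)) \<and>
     (\<forall>n m. L2_inner (power_fun (lam n)) (r m) = (if m = n then 1 else 0))"

text \<open>\<open>fps_nth (fps_expansion f 0) n\<close> is the \<open>n\<close>-th Taylor coefficient of \<open>f\<close> at \<open>0\<close>.\<close>

definition hardy_H2 :: "(complex \<Rightarrow> complex) set" where
  "hardy_H2 = {f. f analytic_on ball 0 1 \<and>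
                  summable (\<lambda>n. (cmod (fps_nth (fps_expansion f 0) n))\<^sup>2)}"

definition hardy_H2_on :: "nat set \<Rightarrow> (complex \<Rightarrow> complex) set" where
  "hardy_H2_on \<Lambda> = {f \<in> hardy_H2. \<forall>n. n \<notin> \<Lambda> \<longrightarrow> fps_nth (fps_expansion f 0) n = 0}"

end

theory Submission
  imports Defs "HOL-Real_Asymp.Real_Asymp"
begin

text \<open>
  For \<open>p = \<Sum> c\<^sub>m t\<^sup>m\<close> the map \<open>c\<^sub>m \<mapsto> c\<^sub>m (m - k) / (m + k + 1)\<close> annihilates the exponent \<open>k\<close>
  and does not increase the \<open>L\<^sup>2\<close> norm: the squared norms differ by
  \<open>(2k + 1) |\<Sum> c\<^sub>m / (m + k + 1)|\<^sup>2\<close>. Removing all exponents but \<open>l\<close> gives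
  \<open>|c\<^sub>l|\<^sup>2 \<le> (2l + 1) \<Prod> ((l + k + 1) / (l - k))\<^sup>2 \<parallel>p\<parallel>\<^sup>2\<close>, and the convergence of
  \<open>\<Sum> 1 / \<lambda>\<^sub>n\<close> turns this into \<open>|c\<^sub>l| \<le> R\<^sup>l \<parallel>p\<parallel>\<close> with \<open>R\<close> independent of \<open>p\<close>. So if Muntz
  polynomials \<open>p\<^sub>j\<close> converge to \<open>f\<close> in \<open>L\<^sup>2\<close>, they converge uniformly on a disk about \<open>0\<close>. As \<open>f\<close> is
  analytic, its Taylor coefficients are the limits of the coefficients of the \<open>p\<^sub>j\<close>: they
  vanish off \<open>\<Lambda>\<close> and equal \<open>\<langle>f, r\<^sub>n\<rangle>\<close> at \<open>\<lambda>\<^sub>n\<close>. Any radius suffices here, so a crude \<open>R\<close> is enough.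
  Conversely, the Taylor polynomials of a function in \<open>H\<^sup>2(D, \<Lambda>)\<close> converge to it in \<open>L\<^sup>2(0,1)\<close> by
  the Cauchy--Schwarz inequality, because \<open>\<Sum> \<parallel>t\<^bsup>\<lambda>\<^sub>n\<^esup>\<parallel>\<^sup>2 = \<Sum> 1 / (2\<lambda>\<^sub>n + 1) < \<infinity>\<close>.
\<close>

section \<open>Coefficient estimates for Muntz polynomials\<close>

text \<open>Coefficients are indexed by the exponent and not, as in \<open>linear_span\<close>, by
  the function. A multiplier then acts by changing \<open>c\<close> while the set \<open>F\<close>
  of exponents stays fixed.\<close>

definition muntz_poly :: "(nat \<Rightarrow> complex) \<Rightarrow> nat set \<Rightarrow> real \<Rightarrow> complex" where
  "muntz_poly c F t = (\<Sum>k\<in>F. c k * power_fun k t)"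

section \<open>Integrals of continuous functions and powers over (0,1)\<close>

lemma integrable_unit_interval:
  fixes g :: "real \<Rightarrow> 'b::euclidean_space"
  assumes "continuous_on {0..1} g"
  shows "integrable unit_interval_measure g"
proof -
  have "set_integrable lebesgue {0<..<1} g"
    using absolutely_integrable_continuous_real[OF assms]
    by (rule set_integrable_subset) auto
  then show ?thesis
    by (simp add: integrable_restrict_space set_integrable_def)
qed

lemma integral_unit_interval_power:
  "(\<integral>t. t ^ k \<partial>unit_interval_measure) = 1 / (real k + 1)"
proof -
  have "integrable unit_interval_measure (\<lambda>t::real. t ^ k)"
    by (intro integrable_unit_interval continuous_intros)
  then have "(\<integral>t. t ^ k \<partial>unit_interval_measure) = integral {0<..<1::real} (\<lambda>t. t ^ k)"
    by (rule lebesgue_integral_eq_integral) auto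
  also have "\<dots> = integral {0..1} (\<lambda>t::real. t ^ k)"
    by (simp add: integral_open_interval_real)
  also have "\<dots> = 1 ^ Suc k / real (Suc k) - 0 ^ Suc k / real (Suc k)"
    by (rule integral_unique, rule fundamental_theorem_of_calculus)
       (auto intro!: derivative_eq_intros simp: has_real_derivative_iff_has_vector_derivative[symmetric]
          simp del: power_Suc of_nat_Suc)
  finally show ?thesis by simp
qed

lemma continuous_muntz_poly [continuous_intros]: "continuous_on S (muntz_poly c F)"
  unfolding muntz_poly_def power_fun_def by (intro continuous_intros)

lemma continuous_in_L2_01: "continuous_on {0..1} g \<Longrightarrow> g \<in> L2_01"
  unfolding L2_01_def
  by (auto intro!: integrable_unit_interval borel_measurable_integrable continuous_intros)

lemma muntz_poly_in_L2_01: "muntz_poly c F \<in> L2_01"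
  by (intro continuous_in_L2_01 continuous_intros)

lemma L2_norm_sq: "(L2_norm g)\<^sup>2 = (\<integral>t. (cmod (g t))\<^sup>2 \<partial>unit_interval_measure)"
  unfolding L2_norm_def by simp

lemma L2_norm_nonneg: "0 \<le> L2_norm g"
  unfolding L2_norm_def by simp

text \<open>The Gram matrix of the powers is the Hilbert matrix, since the integral of
  \<open>t ^ (m + n)\<close> is \<open>1 / (m + n + 1)\<close>. Stating this over the complex
  numbers avoids showing separately that the double sum is real.\<close>

lemma L2_norm_muntz_poly:
  "complex_of_real ((L2_norm (muntz_poly c F))\<^sup>2) =
     (\<Sum>m\<in>F. \<Sum>n\<in>F. c m * cnj (c n) / of_nat (m + n + 1))"
proof -
  have sq: "complex_of_real ((cmod (muntz_poly c F t))\<^sup>2) =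
      (\<Sum>m\<in>F. \<Sum>n\<in>F. c m * cnj (c n) * complex_of_real (t ^ (m + n)))" for t
    unfolding complex_norm_square muntz_poly_def power_fun_def
    by (simp add: sum_product power_add mult_ac)
  have int: "integrable unit_interval_measure (\<lambda>t. c m * cnj (c n) * complex_of_real (t ^ (m + n)))" for m n
    by (intro integrable_unit_interval continuous_intros)
  have "complex_of_real ((L2_norm (muntz_poly c F))\<^sup>2) =
      (\<integral>t. (\<Sum>m\<in>F. \<Sum>n\<in>F. c m * cnj (c n) * complex_of_real (t ^ (m + n))) \<partial>unit_interval_measure)"
    unfolding L2_norm_sq integral_complex_of_real[symmetric] sq ..
  also have "\<dots> = (\<Sum>m\<in>F. \<Sum>n\<in>F. c m * cnj (c n) *
      (\<integral>t. complex_of_real (t ^ (m + n)) \<partial>unit_interval_measure))"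
    using int by simp
  finally show ?thesis
    by (simp only: integral_complex_of_real integral_unit_interval_power) (simp add: add_ac)
qed

text \<open>The multiplier is the Blaschke-type factor that annihilates the exponent \<open>k\<close>.\<close>

lemma L2_norm_muntz_poly_contraction:
  "(L2_norm (muntz_poly (\<lambda>m. (of_nat m - of_nat k) / of_nat (m + k + 1) * c m) F))\<^sup>2
     \<le> (L2_norm (muntz_poly c F))\<^sup>2"
proof -
  let ?d = "\<lambda>m. (of_nat m - of_nat k) / of_nat (m + k + 1) * c m"
  define s where "s = (\<Sum>m\<in>F. c m / of_nat (m + k + 1))"
  \<comment> \<open>The difference of the two Hermitian forms has a rank-one kernel with positive
    factor \<open>2 * k + 1\<close>. Summed over \<open>m\<close> and \<open>n\<close>, it becomes a
    multiple of \<open>s * cnj s\<close>.\<close>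
  have kernel: "c m * cnj (c n) / of_nat (m + n + 1) - ?d m * cnj (?d n) / of_nat (m + n + 1)
      = of_nat (2 * k + 1) * (c m / of_nat (m + k + 1) * cnj (c n / of_nat (n + k + 1)))" for m n
  proof -
    define x y z :: complex where "x = of_nat (m + k + 1)" and "y = of_nat (n + k + 1)"
      and "z = of_nat (m + n + 1)"
    have nz: "x \<noteq> 0" "y \<noteq> 0" "z \<noteq> 0"
      unfolding x_def y_def z_def Suc_eq_plus1[symmetric] by (rule of_nat_neq_0)+
    \<comment> \<open>The numerator contains the factor \<open>z\<close>, which cancels the
      Hilbert-matrix denominator and leaves a product of a term in \<open>m\<close> and a term in
      \<open>n\<close>.\<close>
    have id: "x * y - (of_nat m - of_nat k) * (of_nat n - of_nat k) = of_nat (2 * k + 1) * z"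
      unfolding x_def y_def z_def by (simp add: algebra_simps)
    have "cnj x = x" "cnj y = y"
      by (simp_all add: x_def y_def)
    then have "c m * cnj (c n) / z - ((of_nat m - of_nat k) / x * c m) * cnj ((of_nat n - of_nat k) / y * c n) / z
        = c m * cnj (c n) * (x * y - (of_nat m - of_nat k) * (of_nat n - of_nat k)) / (x * y * z)"
      using nz by (simp add: field_simps)
    also have "\<dots> = of_nat (2 * k + 1) * (c m / x * cnj (c n / y))"
      unfolding id using nz \<open>cnj y = y\<close> by (simp add: field_simps)
    finally show ?thesis
      unfolding x_def y_def z_def .
  qed
  have "complex_of_real ((L2_norm (muntz_poly c F))\<^sup>2 - (L2_norm (muntz_poly ?d F))\<^sup>2)
      = (\<Sum>m\<in>F. \<Sum>n\<in>F. of_nat (2 * k + 1) * (c m / of_nat (m + k + 1) * cnj (c n / of_nat (n + k + 1))))"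
    unfolding of_real_diff L2_norm_muntz_poly sum_subtractf[symmetric] kernel ..
  also have "\<dots> = of_nat (2 * k + 1) * (s * cnj s)"
    unfolding s_def cnj_sum sum_product by (simp only: sum_distrib_left)
  also have "\<dots> = complex_of_real (real (2 * k + 1) * (cmod s)\<^sup>2)"
    unfolding of_real_mult complex_norm_square of_real_of_nat_eq ..
  finally have "(L2_norm (muntz_poly c F))\<^sup>2 - (L2_norm (muntz_poly ?d F))\<^sup>2 = real (2 * k + 1) * (cmod s)\<^sup>2"
    by (simp only: of_real_eq_iff)
  moreover have "0 \<le> real (2 * k + 1) * (cmod s)\<^sup>2" by simp
  ultimately show ?thesis by linarith
qed

lemma L2_norm_muntz_poly_prod_contraction:
  assumes "finite A"
  shows "(L2_norm (muntz_poly (\<lambda>m. (\<Prod>k\<in>A. (of_nat m - of_nat k) / of_nat (m + k + 1)) * c m) F))\<^sup>2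
           \<le> (L2_norm (muntz_poly c F))\<^sup>2"
  using assms
proof (induction A rule: finite_induct)
  case (insert k A)
  then show ?case
    using L2_norm_muntz_poly_contraction[of k
        "\<lambda>m. (\<Prod>k\<in>A. (of_nat m - of_nat k) / of_nat (m + k + 1)) * c m" F]
    by (simp add: mult.assoc)
qed simp

lemma muntz_poly_coeff_le:
  assumes "finite F" "l \<in> F"
  shows "(cmod (c l))\<^sup>2 \<le> real (2 * l + 1) *
    (\<Prod>k\<in>F - {l}. real (l + k + 1) / \<bar>real l - real k\<bar>)\<^sup>2 * (L2_norm (muntz_poly c F))\<^sup>2"
proof -
  \<comment> \<open>Taking one factor for every exponent other than \<open>l\<close> leaves
    \<open>b l\<close> as the only coefficient that can be nonzero, so the norm of the new
    polynomial is explicit.\<close>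
  define b :: "nat \<Rightarrow> complex" where
    "b m = (\<Prod>k\<in>F - {l}. (of_nat m - of_nat k) / of_nat (m + k + 1)) * c m" for m
  define P where "P = (\<Prod>k\<in>F - {l}. real (l + k + 1) / \<bar>real l - real k\<bar>)"
  have b0: "b m = 0" if "m \<in> F" "m \<noteq> l" for m
    using that assms(1) unfolding b_def by (auto simp: prod_zero_iff)
  have P0: "P > 0"
    unfolding P_def by (intro prod_pos) auto
  have "cmod (\<Prod>k\<in>F - {l}. (of_nat l - of_nat k) / of_nat (l + k + 1)) =
      (\<Prod>k\<in>F - {l}. \<bar>real l - real k\<bar> / real (l + k + 1))"
    unfolding prod_norm[symmetric] norm_divide norm_of_nat
    by (intro prod.cong refl arg_cong2[where f="(/)"])
       (metis norm_of_real of_real_diff of_real_of_nat_eq)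
  also have "\<dots> = inverse P"
    unfolding P_def prod_inversef[symmetric] by (intro prod.cong) auto
  finally have bl: "cmod (b l) = cmod (c l) / P"
    unfolding b_def norm_mult by (simp add: field_simps)
  have "complex_of_real ((L2_norm (muntz_poly b F))\<^sup>2) =
      (\<Sum>m\<in>F. if m = l then (\<Sum>n\<in>F. if n = l then b l * cnj (b l) / of_nat (l + l + 1) else 0) else 0)"
    unfolding L2_norm_muntz_poly
  proof (intro sum.cong refl)
    fix m assume m: "m \<in> F"
    show "(\<Sum>n\<in>F. b m * cnj (b n) / of_nat (m + n + 1)) =
        (if m = l then (\<Sum>n\<in>F. if n = l then b l * cnj (b l) / of_nat (l + l + 1) else 0) else 0)"
    proof (cases "m = l")
      case True
      have "b l * cnj (b n) / of_nat (l + n + 1) = (if n = l then b l * cnj (b l) / of_nat (l + l + 1) else 0)"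
        if "n \<in> F" for n
        using b0[OF that] by (cases "n = l") simp_all
      then show ?thesis
        unfolding True by (simp only: if_True simp_thms cong: sum.cong)
    qed (use m in \<open>simp add: b0\<close>)
  qed
  also have "\<dots> = b l * cnj (b l) / of_nat (l + l + 1)"
    using assms by (simp only: sum.delta if_True)
  also have "\<dots> = complex_of_real ((cmod (b l))\<^sup>2 / real (2 * l + 1))"
    unfolding of_real_divide complex_norm_square of_real_of_nat_eq mult_2 ..
  finally have "(L2_norm (muntz_poly b F))\<^sup>2 = (cmod (b l))\<^sup>2 / real (2 * l + 1)"
    by (simp only: of_real_eq_iff)
  moreover have "(L2_norm (muntz_poly b F))\<^sup>2 \<le> (L2_norm (muntz_poly c F))\<^sup>2"
    using L2_norm_muntz_poly_prod_contraction[of "F - {l}" c F] assms(1) unfolding b_def by simp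
  ultimately have "(cmod (c l) / P)\<^sup>2 / real (2 * l + 1) \<le> (L2_norm (muntz_poly c F))\<^sup>2"
    unfolding bl by simp
  moreover have "0 < real (2 * l + 1)" by simp
  ultimately show ?thesis
    using P0 unfolding P_def[symmetric] power_divide
    by (simp only: pos_divide_le_eq zero_less_power mult_ac)
qed

section \<open>Products over separated exponents\<close>

text \<open>The product is \<open>(n + 1) ... (n + l) / l!\<close>. It is used with
  \<open>n = 2 * l + 1\<close>, where \<open>j\<close> is the distance of an exponent from
  \<open>l\<close>.\<close>

lemma prod_Suc_add_div_eq_binomial:
  "(\<Prod>j=1..l. (real n + real j) / real j) = real ((n + l) choose l)"
proof (induction l)
  case (Suc l)
  have "Suc l * (Suc (n + l) choose Suc l) = Suc (n + l) * ((n + l) choose l)"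
    by (metis Suc_times_binomial_eq mult.commute)
  then have "real (Suc l) * real (Suc (n + l) choose Suc l) = real (Suc (n + l)) * real ((n + l) choose l)"
    unfolding of_nat_mult[symmetric] by (rule arg_cong)
  with Suc show ?case by (simp add: field_simps)
qed simp

text \<open>Every factor is at least 1, so \<open>A\<close> may be enlarged to all of
  \<open>{1..l}\<close>. The full product is a binomial coefficient with upper index
  \<open>3 * l + 1\<close>.\<close>

lemma prod_near_le:
  assumes "A \<subseteq> {1..l}"
  shows "(\<Prod>j\<in>A. (real (2 * l + 1) + real j) / real j) \<le> 2 ^ (3 * l + 1)"
proof -
  have "(\<Prod>j\<in>A. (real (2 * l + 1) + real j) / real j) \<le> (\<Prod>j=1..l. (real (2 * l + 1) + real j) / real j)"
    by (rule prod_mono2) (use assms in \<open>auto simp: field_simps\<close>)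
  also have "\<dots> = real ((2 * l + 1 + l) choose l)"
    by (rule prod_Suc_add_div_eq_binomial)
  also have "\<dots> \<le> real (2 ^ (2 * l + 1 + l))"
    using binomial_le_pow2 by (simp only: of_nat_le_iff)
  finally show ?thesis by (simp add: algebra_simps)
qed

text \<open>Exponents within distance \<open>l\<close> of \<open>l\<close> contribute binomial coefficients; for the others,
  \<open>(l + k + 1) / (k - l) \<le> 1 + 6l / k \<le> exp (6l / k)\<close>.\<close>

lemma prod_separation_le:
  assumes "finite A" "l \<notin> A" "0 < l" "0 \<notin> A"
  shows "(\<Prod>k\<in>A. real (l + k + 1) / \<bar>real l - real k\<bar>)
    \<le> (2 ^ 8) ^ l * exp (6 * real l * (\<Sum>k\<in>A. 1 / real k))"
proof -
  let ?q = "\<lambda>k. real (l + k + 1) / \<bar>real l - real k\<bar>"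
  define A1 A2 A3 where "A1 = {k\<in>A. k < l}" and "A2 = {k\<in>A. l < k \<and> k \<le> 2 * l}"
    and "A3 = {k\<in>A. 2 * l < k}"
  have fin: "finite A1" "finite A2" "finite A3"
    using assms(1) by (auto simp: A1_def A2_def A3_def)
  have A: "A = A1 \<union> A2 \<union> A3"
    using assms(2) by (auto simp: A1_def A2_def A3_def)
      (metis linorder_neqE_nat linorder_not_less)
  have split: "prod ?q A = prod ?q A1 * prod ?q A2 * prod ?q A3"
  proof -
    have "prod ?q A = prod ?q (A1 \<union> A2) * prod ?q A3"
      unfolding A by (intro prod.union_disjoint) (use fin in \<open>auto simp: A1_def A2_def A3_def\<close>)
    also have "prod ?q (A1 \<union> A2) = prod ?q A1 * prod ?q A2"
      by (intro prod.union_disjoint) (use fin in \<open>auto simp: A1_def A2_def A3_def\<close>)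
    finally show ?thesis .
  qed
  \<comment> \<open>For \<open>k = l - j\<close> the numerator is \<open>2 * l + 1 - j\<close>.
    Raising it to \<open>2 * l + 1 + j\<close> gives the same shape as for \<open>k = l + j\<close>,
    where it is exact.\<close>
  have "prod ?q A1 \<le> (\<Prod>k\<in>A1. (real (2 * l + 1) + real (l - k)) / real (l - k))"
    by (intro prod_mono) (auto simp: A1_def of_nat_diff intro!: divide_right_mono)
  also have "\<dots> = (\<Prod>j\<in>(\<lambda>k. l - k) ` A1. (real (2 * l + 1) + real j) / real j)"
    by (subst prod.reindex) (auto simp: A1_def inj_on_def)
  also have "\<dots> \<le> 2 ^ (3 * l + 1)"
    by (intro prod_near_le) (auto simp: A1_def)
  finally have 1: "prod ?q A1 \<le> 2 ^ (3 * l + 1)" .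
  have "prod ?q A2 = (\<Prod>k\<in>A2. (real (2 * l + 1) + real (k - l)) / real (k - l))"
    by (intro prod.cong) (auto simp: A2_def of_nat_diff)
  also have "\<dots> = (\<Prod>j\<in>(\<lambda>k. k - l) ` A2. (real (2 * l + 1) + real j) / real j)"
    by (subst prod.reindex) (auto simp: A2_def inj_on_def)
  also have "\<dots> \<le> 2 ^ (3 * l + 1)"
    by (intro prod_near_le) (auto simp: A2_def)
  finally have 2: "prod ?q A2 \<le> 2 ^ (3 * l + 1)" .
  have "prod ?q A3 \<le> (\<Prod>k\<in>A3. exp (6 * real l * (1 / real k)))"
  proof (intro prod_mono conjI)
    fix k assume "k \<in> A3"
    then have k: "2 * l < k" by (simp add: A3_def)
    have "?q k \<le> 1 + 6 * real l / real k"
    proof -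
      have "?q k = 1 + real (2 * l + 1) / (real k - real l)"
        using k by (simp add: field_simps)
      \<comment> \<open>Here \<open>2 * l + 1 \<le> 3 * l\<close> because \<open>l\<close> is
        positive, and \<open>k - l \<ge> k / 2\<close> because \<open>k > 2 * l\<close>.\<close>
      also have "real (2 * l + 1) / (real k - real l) \<le> (3 * real l) / (real k / 2)"
        by (rule frac_le) (use k assms(3) in auto)
      finally show ?thesis by simp
    qed
    also have "\<dots> \<le> exp (6 * real l * (1 / real k))"
      using exp_ge_add_one_self[of "6 * real l / real k"] by simp
    finally show "?q k \<le> exp (6 * real l * (1 / real k))" .
  qed auto
  also have "\<dots> = exp (6 * real l * (\<Sum>k\<in>A3. 1 / real k))"
    unfolding sum_distrib_left by (rule exp_sum[symmetric]) (rule fin)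
  also have "\<dots> \<le> exp (6 * real l * (\<Sum>k\<in>A. 1 / real k))"
    unfolding exp_le_cancel_iff using assms(1)
    by (intro mult_left_mono sum_mono2) (auto simp: A3_def)
  finally have 3: "prod ?q A3 \<le> exp (6 * real l * (\<Sum>k\<in>A. 1 / real k))" .
  have "prod ?q A \<le> 2 ^ (3 * l + 1) * 2 ^ (3 * l + 1) * exp (6 * real l * (\<Sum>k\<in>A. 1 / real k))"
    unfolding split by (intro mult_mono 1 2 3) (auto intro!: prod_nonneg mult_nonneg_nonneg)
  \<comment> \<open>The exponent \<open>6 * l + 2\<close> is at most \<open>8 * l\<close> because
    \<open>l \<ge> 1\<close>.\<close>
  also have "(2::real) ^ (3 * l + 1) * 2 ^ (3 * l + 1) \<le> (2 ^ 8) ^ l"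
    unfolding power_add[symmetric] power_mult[symmetric]
    using assms(3) by (intro power_increasing) auto
  finally show ?thesis by simp
qed

lemma muntz_poly_coeff_exponential_bound:
  fixes lam :: "nat \<Rightarrow> nat"
  assumes "strict_mono lam" "\<And>n. lam n > 0" "summable (\<lambda>n. 1 / real (lam n))"
  obtains R where "R \<ge> 1"
    "\<And>F c l. finite F \<Longrightarrow> F \<subseteq> range lam \<Longrightarrow> l \<in> F \<Longrightarrow>
       cmod (c l) \<le> R ^ l * L2_norm (muntz_poly c F)"
proof -
  define S where "S = (\<Sum>n. 1 / real (lam n))"
  have S0: "S \<ge> 0" unfolding S_def by (intro suminf_nonneg assms(3)) auto
  \<comment> \<open>The factor \<open>2 ^ 8 * exp (6 * S)\<close> bounds the separation product,
    with the full sum \<open>S\<close> replacing the sum over \<open>F - {l}\<close>. The leading 2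
    absorbs \<open>2 * l + 1 \<le> (2 ^ l)\<^sup>2\<close>.\<close>
  define R where "R = 2 * (2 ^ 8 * exp (6 * S))"
  have R1: "R \<ge> 1"
  proof -
    have "1 \<le> exp (6 * S)" using S0 by simp
    then show ?thesis unfolding R_def by (simp del: one_le_exp_iff)
  qed
  have "cmod (c l) \<le> R ^ l * L2_norm (muntz_poly c F)"
    if F: "finite F" "F \<subseteq> range lam" "l \<in> F" for F c l
  proof -
    have "k > 0" if "k \<in> F" for k
      using F(2) assms(2) that by blast
    then have l: "l > 0" "0 \<notin> F" using F(3) by blast+
    define I where "I = lam -` (F - {l})"
    have inj: "inj lam" using assms(1) by (rule strict_mono_imp_inj_on)
    have I: "finite I" "F - {l} = lam ` I"
      unfolding I_def using F finite_vimageI[OF _ inj] by auto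
    have "(\<Sum>k\<in>F - {l}. 1 / real k) = (\<Sum>n\<in>I. 1 / real (lam n))"
      unfolding I(2) by (subst sum.reindex) (auto intro: inj_on_subset[OF inj])
    also have "\<dots> \<le> S"
      unfolding S_def by (intro sum_le_suminf assms(3) I) auto
    finally have S: "(\<Sum>k\<in>F - {l}. 1 / real k) \<le> S" .
    define P where "P = (\<Prod>k\<in>F - {l}. real (l + k + 1) / \<bar>real l - real k\<bar>)"
    have "P \<le> (2 ^ 8) ^ l * exp (6 * real l * (\<Sum>k\<in>F - {l}. 1 / real k))"
      unfolding P_def by (rule prod_separation_le) (use F l in auto)
    also have "\<dots> \<le> (2 ^ 8) ^ l * exp (6 * real l * S)"
      using S by (auto intro!: mult_left_mono)
    also have "exp (6 * real l * S) = exp (6 * S) ^ l"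
      unfolding exp_of_nat_mult[symmetric] by (simp add: mult_ac)
    finally have P: "P \<le> (2 ^ 8 * exp (6 * S)) ^ l"
      by (simp add: power_mult_distrib)
    have P0: "P \<ge> 0" unfolding P_def by (intro prod_nonneg) auto
    have "real (2 * l + 1) \<le> (2 ^ l)\<^sup>2"
    proof -
      have "2 * l + 1 \<le> 2 ^ Suc l"
        using less_exp[of l] unfolding power_Suc by linarith
      also have "(2::nat) ^ Suc l \<le> 2 ^ (l * 2)"
        using l(1) by (intro power_increasing) auto
      finally have "real (2 * l + 1) \<le> real (2 ^ (l * 2))" by (simp only: of_nat_le_iff)
      then show ?thesis by (simp add: power_mult)
    qed
    then have "real (2 * l + 1) * P\<^sup>2 \<le> (2 ^ l)\<^sup>2 * ((2 ^ 8 * exp (6 * S)) ^ l)\<^sup>2"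
      using P P0 by (intro mult_mono power_mono) auto
    also have "\<dots> = (R ^ l)\<^sup>2"
      unfolding R_def power_mult_distrib[symmetric] ..
    finally have "real (2 * l + 1) * P\<^sup>2 * (L2_norm (muntz_poly c F))\<^sup>2
        \<le> (R ^ l)\<^sup>2 * (L2_norm (muntz_poly c F))\<^sup>2"
      by (rule mult_right_mono) simp
    with muntz_poly_coeff_le[OF F(1,3), of c]
    have "(cmod (c l))\<^sup>2 \<le> (R ^ l * L2_norm (muntz_poly c F))\<^sup>2"
      unfolding P_def power_mult_distrib by linarith
    then show ?thesis
      by (rule power2_le_imp_le) (use R1 L2_norm_nonneg in auto)
  qed
  with R1 show ?thesis by (rule that)
qed

section \<open>Inner products and closed spans\<close>

lemma L2_01_integrable: "g \<in> L2_01 \<Longrightarrow> integrable unit_interval_measure (\<lambda>t. (cmod (g t))\<^sup>2)"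
  and L2_01_measurable: "g \<in> L2_01 \<Longrightarrow> g \<in> borel_measurable unit_interval_measure"
  unfolding L2_01_def by auto

lemma cmod_diff_sq_le: "(cmod (x - y))\<^sup>2 \<le> 2 * (cmod x)\<^sup>2 + 2 * (cmod y)\<^sup>2"
proof -
  have "(cmod (x - y))\<^sup>2 \<le> (cmod x + cmod y)\<^sup>2"
    by (intro power_mono norm_triangle_ineq4) auto
  also have "\<dots> \<le> 2 * (cmod x)\<^sup>2 + 2 * (cmod y)\<^sup>2"
    using zero_le_power2[of "cmod x - cmod y"] by (simp add: power2_eq_square algebra_simps)
  finally show ?thesis .
qed

lemma L2_01_diff:
  assumes "g \<in> L2_01" "h \<in> L2_01"
  shows "(\<lambda>t. g t - h t) \<in> L2_01"
    and "(L2_norm (\<lambda>t. g t - h t))\<^sup>2 \<le> 2 * (L2_norm g)\<^sup>2 + 2 * (L2_norm h)\<^sup>2"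
proof -
  note [measurable] = assms[THEN L2_01_measurable]
  note int = assms[THEN L2_01_integrable]
  have int': "integrable unit_interval_measure (\<lambda>t. 2 * (cmod (g t))\<^sup>2 + 2 * (cmod (h t))\<^sup>2)"
    using int by simp
  have *: "integrable unit_interval_measure (\<lambda>t. (cmod (g t - h t))\<^sup>2)"
    by (rule Bochner_Integration.integrable_bound[OF int'])
       (use cmod_diff_sq_le in \<open>auto intro!: AE_I2 simp: abs_of_nonneg\<close>)
  then show "(\<lambda>t. g t - h t) \<in> L2_01"
    unfolding L2_01_def by simp
  have "(L2_norm (\<lambda>t. g t - h t))\<^sup>2 \<le>
      (\<integral>t. 2 * (cmod (g t))\<^sup>2 + 2 * (cmod (h t))\<^sup>2 \<partial>unit_interval_measure)"
    unfolding L2_norm_sq by (intro integral_mono * int' cmod_diff_sq_le)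
  also have "\<dots> = 2 * (L2_norm g)\<^sup>2 + 2 * (L2_norm h)\<^sup>2"
    unfolding L2_norm_sq using int by simp
  finally show "(L2_norm (\<lambda>t. g t - h t))\<^sup>2 \<le> 2 * (L2_norm g)\<^sup>2 + 2 * (L2_norm h)\<^sup>2" .
qed

lemma L2_inner_integrable:
  assumes "g \<in> L2_01" "h \<in> L2_01"
  shows "integrable unit_interval_measure (\<lambda>t. g t * cnj (h t))"
proof -
  note [measurable] = assms[THEN L2_01_measurable]
  have int: "integrable unit_interval_measure (\<lambda>t. (cmod (g t))\<^sup>2 + (cmod (h t))\<^sup>2)"
    using assms[THEN L2_01_integrable] by simp
  have "cmod (g t) * cmod (h t) \<le> (cmod (g t))\<^sup>2 + (cmod (h t))\<^sup>2" for t
  proof -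
    have "0 \<le> (cmod (g t) - cmod (h t))\<^sup>2 + (cmod (g t))\<^sup>2 + (cmod (h t))\<^sup>2" by simp
    then show ?thesis by (simp add: power2_eq_square algebra_simps)
  qed
  moreover have "(\<lambda>t. g t * cnj (h t)) \<in> borel_measurable unit_interval_measure"
    using borel_measurable_continuous_onI[OF continuous_on_cnj[OF continuous_on_id]]
    by measurable
  ultimately show ?thesis
    by (intro Bochner_Integration.integrable_bound[OF int]) (auto intro!: AE_I2 simp: norm_mult)
qed

text \<open>Weighted AM-GM with weight \<open>s\<close>; the shift by \<open>d\<close> avoids a division by zero.\<close>

lemma L2_Cauchy_Schwarz:
  assumes "g \<in> L2_01" "h \<in> L2_01"
  shows "cmod (L2_inner g h) \<le> L2_norm g * L2_norm h"
proof -
  let ?a = "L2_norm g" and ?b = "L2_norm h"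
  have ineq: "cmod (L2_inner g h) \<le> (?a + d) * (?b + d)" if "d > 0" for d
  proof -
    \<comment> \<open>This weight balances the two terms: each becomes half of
      \<open>(?a + d) * (?b + d)\<close>. Letting \<open>d\<close> tend to 0 from the right then
      gives the claim.\<close>
    define s where "s = (?b + d) / (?a + d)"
    have pos: "?a + d > 0" "?b + d > 0"
      using that L2_norm_nonneg[of g] L2_norm_nonneg[of h] by linarith+
    have s: "s > 0" unfolding s_def using pos by simp
    have "cmod (L2_inner g h) \<le> (\<integral>t. s / 2 * (cmod (g t))\<^sup>2 + 1 / (2 * s) * (cmod (h t))\<^sup>2 \<partial>unit_interval_measure)"
      unfolding L2_inner_def
    proof (rule order_trans[OF integral_norm_bound integral_mono])
      show "integrable unit_interval_measure (\<lambda>t. cmod (g t * cnj (h t)))"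
        using assms by (intro integrable_norm L2_inner_integrable)
      show "integrable unit_interval_measure (\<lambda>t. s / 2 * (cmod (g t))\<^sup>2 + 1 / (2 * s) * (cmod (h t))\<^sup>2)"
        by (intro Bochner_Integration.integrable_add integrable_mult_right assms[THEN L2_01_integrable])
      fix t
      have "0 \<le> (s * cmod (g t) - cmod (h t))\<^sup>2 / (2 * s)" using s by simp
      also have "\<dots> = s / 2 * (cmod (g t))\<^sup>2 + 1 / (2 * s) * (cmod (h t))\<^sup>2 - cmod (g t) * cmod (h t)"
        using s by (simp add: field_simps power2_eq_square)
      finally show "cmod (g t * cnj (h t)) \<le> s / 2 * (cmod (g t))\<^sup>2 + 1 / (2 * s) * (cmod (h t))\<^sup>2"
        by (simp add: norm_mult)
    qed
    also have "\<dots> = s / 2 * ?a\<^sup>2 + 1 / (2 * s) * ?b\<^sup>2"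
      unfolding L2_norm_sq using assms[THEN L2_01_integrable] by simp
    also have "\<dots> \<le> s / 2 * (?a + d)\<^sup>2 + 1 / (2 * s) * (?b + d)\<^sup>2"
      using s that L2_norm_nonneg by (intro add_mono mult_left_mono power_mono) auto
    also have "\<dots> = (?a + d) * (?b + d)"
    proof -
      have "y / x / 2 * x\<^sup>2 + 1 / (2 * (y / x)) * y\<^sup>2 = x * y" if "x > 0" "y > 0" for x y :: real
        using that by (simp add: power2_eq_square)
      from this[OF pos] show ?thesis unfolding s_def .
    qed
    finally show ?thesis .
  qed
  have lim: "((\<lambda>d. (?a + d) * (?b + d)) \<longlongrightarrow> (?a + 0) * (?b + 0)) (at_right 0)"
    by (intro tendsto_intros)
  have "cmod (L2_inner g h) \<le> (?a + 0) * (?b + 0)"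
    by (rule tendsto_lowerbound[OF lim])
       (use ineq in \<open>auto simp: eventually_at_right_less intro: eventually_mono[OF eventually_at_right_less]\<close>)
  then show ?thesis by simp
qed

text \<open>By Cauchy-Schwarz, norm convergence implies convergence of inner products. This carries
  biorthogonality from Muntz polynomials to their limits.\<close>

lemma L2_inner_tendsto:
  assumes "g \<in> L2_01" "\<And>j. p j \<in> L2_01" "h \<in> L2_01"
    and "(\<lambda>j. L2_norm (\<lambda>t. g t - p j t)) \<longlonglongrightarrow> 0"
  shows "(\<lambda>j. L2_inner (p j) h) \<longlonglongrightarrow> L2_inner g h"
proof -
  have "L2_inner g h - L2_inner (p j) h = L2_inner (\<lambda>t. g t - p j t) h" for j
    unfolding L2_inner_def left_diff_distrib
    by (rule Bochner_Integration.integral_diff[symmetric]) (intro L2_inner_integrable assms)+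
  then have bound: "norm (L2_inner g h - L2_inner (p j) h) \<le> L2_norm (\<lambda>t. g t - p j t) * L2_norm h" for j
    using L2_Cauchy_Schwarz[OF L2_01_diff(1)[OF assms(1,2)] assms(3)] by simp
  have "(\<lambda>j. L2_inner g h - L2_inner (p j) h) \<longlonglongrightarrow> 0"
    by (rule Lim_null_comparison[OF always_eventually[OF allI[OF bound]]])
       (rule tendsto_mult_left_zero[OF assms(4)])
  from tendsto_diff[OF tendsto_const[of "L2_inner g h"] this] show ?thesis by simp
qed

text \<open>The value at \<open>1 / 2\<close> already determines the exponent. Injectivity
  translates between coefficients indexed by functions in \<open>linear_span\<close> and by
  exponents in \<open>muntz_poly\<close>.\<close>

lemma inj_power_fun: "inj power_fun"
proof (rule injI)
  fix m n assume "power_fun m = power_fun n"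
  then have "power_fun m (1 / 2) = power_fun n (1 / 2)" by simp
  then have "(1 / 2 :: real) ^ m = (1 / 2) ^ n"
    unfolding power_fun_def by (simp only: of_real_eq_iff)
  then show "m = n"
    by (simp add: power_one_over)
qed

lemma muntz_poly_in_linear_span:
  assumes "finite F" "F \<subseteq> range lam"
  shows "muntz_poly c F \<in> linear_span (M_sys lam)"
  unfolding linear_span_def
proof (intro CollectI exI conjI)
  show "finite (power_fun ` F)" "power_fun ` F \<subseteq> M_sys lam"
    using assms by (auto simp: M_sys_def)
  show "muntz_poly c F = (\<lambda>t. \<Sum>e\<in>power_fun ` F. c (inv power_fun e) * e t)"
    by (rule ext, subst sum.reindex)
       (auto simp: muntz_poly_def inv_f_f[OF inj_power_fun] intro: inj_on_subset[OF inj_power_fun])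
qed

text \<open>Setting \<open>c\<close> to zero off \<open>F\<close> allows polynomials with different
  exponent sets to be compared over a common larger set, coefficient by coefficient.\<close>

lemma linear_span_muntz_polyE:
  assumes "p \<in> linear_span (M_sys lam)"
  obtains F c where "finite F" "F \<subseteq> range lam" "\<And>k. k \<notin> F \<Longrightarrow> c k = 0" "p = muntz_poly c F"
proof -
  obtain E c where E: "finite E" "E \<subseteq> M_sys lam" "p = (\<lambda>t. \<Sum>e\<in>E. c e * e t)"
    using assms unfolding linear_span_def by auto
  define F where "F = {k \<in> range lam. power_fun k \<in> E}"
  have EF: "E = power_fun ` F"
    using E(2) unfolding F_def M_sys_def by auto
  have "finite F"
    using E(1) unfolding EF by (rule finite_imageD) (rule inj_on_subset[OF inj_power_fun], simp)
  moreover have "p = muntz_poly (\<lambda>k. if k \<in> F then c (power_fun k) else 0) F"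
    unfolding E(3) EF muntz_poly_def
    by (rule ext, subst sum.reindex) (auto intro: inj_on_subset[OF inj_power_fun])
  ultimately show ?thesis
    by (intro that[of F "\<lambda>k. if k \<in> F then c (power_fun k) else 0"]) (auto simp: F_def)
qed

lemma L2_inner_muntz_poly_biorthogonal:
  assumes "strict_mono lam" "biorthogonal_family lam r"
    and "finite F" "F \<subseteq> range lam"
  shows "L2_inner (muntz_poly c F) (r n) = (if lam n \<in> F then c (lam n) else 0)"
proof -
  have rL2: "r n \<in> L2_01"
    using assms(2) unfolding biorthogonal_family_def L2_closed_span_def by auto
  have pL2: "power_fun k \<in> L2_01" for k
    by (rule continuous_in_L2_01) (auto simp: power_fun_def intro!: continuous_intros)
  have "L2_inner (muntz_poly c F) (r n) = (\<Sum>k\<in>F. c k * L2_inner (power_fun k) (r n))"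
    unfolding L2_inner_def muntz_poly_def sum_distrib_right
    using L2_inner_integrable[OF pL2 rL2] by (simp add: mult.assoc)
  also have "\<dots> = (\<Sum>k\<in>F. if k = lam n then c k else 0)"
  proof (intro sum.cong refl)
    fix k assume "k \<in> F"
    then obtain m where k: "k = lam m" using assms(4) by auto
    show "c k * L2_inner (power_fun k) (r n) = (if k = lam n then c k else 0)"
      unfolding k using assms(2) strict_mono_eq[OF assms(1)]
      by (auto simp: biorthogonal_family_def)
  qed
  also have "\<dots> = (if lam n \<in> F then c (lam n) else 0)"
    using assms(3) by (simp add: sum.delta)
  finally show ?thesis .
qed

section \<open>Square summable coefficients\<close>

text \<open>The indicator of \<open>L\<close> can be inserted before Cauchy-Schwarz because
  \<open>b\<close> vanishes elsewhere. Without it the second factor would tend to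
  \<open>1 / (1 - t\<^sup>2)\<close>, which is not integrable on (0,1).\<close>

lemma sq_sum_sparse_le:
  fixes b :: "nat \<Rightarrow> complex" and t :: real
  assumes "\<And>k. k \<notin> L \<Longrightarrow> b k = 0" and "finite K" and "0 \<le> t"
  shows "(cmod (\<Sum>k\<in>K. b k * of_real t ^ k))\<^sup>2
     \<le> (\<Sum>k\<in>K. (cmod (b k))\<^sup>2) * (\<Sum>k\<in>K. of_bool (k \<in> L) * t ^ (2 * k))"
proof -
  have "cmod (\<Sum>k\<in>K. b k * of_real t ^ k) \<le> (\<Sum>k\<in>K. cmod (b k) * (of_bool (k \<in> L) * t ^ k))"
    by (rule order_trans[OF norm_sum], rule sum_mono)
       (use assms(1,3) in \<open>auto simp: norm_mult norm_power of_bool_def\<close>)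
  then have "(cmod (\<Sum>k\<in>K. b k * of_real t ^ k))\<^sup>2
      \<le> (\<Sum>k\<in>K. cmod (b k) * (of_bool (k \<in> L) * t ^ k))\<^sup>2"
    by (intro power_mono) auto
  also have "\<dots> \<le> (\<Sum>k\<in>K. (cmod (b k))\<^sup>2) * (\<Sum>k\<in>K. (of_bool (k \<in> L) * t ^ k)\<^sup>2)"
    by (rule Cauchy_Schwarz_ineq_sum)
  also have "(\<Sum>k\<in>K. (of_bool (k \<in> L) * t ^ k)\<^sup>2) = (\<Sum>k\<in>K. of_bool (k \<in> L) * t ^ (2 * k))"
    by (intro sum.cong refl) (simp add: power_even_eq of_bool_def)
  finally show ?thesis .
qed

text \<open>Termwise integration gives the sum of \<open>1 / (2 * lam n + 1)\<close>, which is
  dominated by the convergent sum of \<open>1 / lam n\<close>.\<close>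

lemma sparse_kernel_integrable:
  assumes "strict_mono lam" "\<And>n. lam n > 0" "summable (\<lambda>n. 1 / real (lam n))"
  shows "integrable unit_interval_measure (\<lambda>t. \<Sum>k. of_bool (k \<in> range lam) * t ^ (2 * k))"
proof (rule integrable_suminf)
  let ?w = "\<lambda>k t::real. of_bool (k \<in> range lam) * t ^ (2 * k)"
  show "integrable unit_interval_measure (?w k)" for k
    by (intro integrable_unit_interval continuous_intros)
  show "AE t in unit_interval_measure. summable (\<lambda>k. norm (?w k t))"
  proof (rule AE_I2)
    fix t assume "t \<in> space unit_interval_measure"
    then have t: "0 < t" "t < 1" by auto
    have "norm (norm (?w k t)) \<le> t ^ k" for k
      using t power_decreasing[of k "2 * k" t] by (auto simp: of_bool_def)
    then show "summable (\<lambda>k. norm (?w k t))"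
      by (rule summable_comparison_test'[rotated]) (use t in \<open>simp add: summable_geometric\<close>)
  qed
  have int: "(\<integral>t. norm (?w k t) \<partial>unit_interval_measure) = of_bool (k \<in> range lam) * (1 / (real (2 * k) + 1))" for k
    unfolding integral_unit_interval_power[symmetric]
    by (auto simp: of_bool_def)
  have "summable (\<lambda>n. of_bool (lam n \<in> range lam) * (1 / (real (2 * lam n) + 1)))"
  proof (rule summable_comparison_test'[OF assms(3)])
    fix n :: nat assume "n \<ge> 0"
    show "norm (of_bool (lam n \<in> range lam) * (1 / (real (2 * lam n) + 1))) \<le> 1 / real (lam n)"
      using assms(2)[of n] by (auto intro!: divide_left_mono)
  qed
  then show "summable (\<lambda>k. \<integral>t. norm (?w k t) \<partial>unit_interval_measure)"
    unfolding int
    using summable_mono_reindex[OF assms(1), of "\<lambda>k. of_bool (k \<in> range lam) * (1 / (real (2 * k) + 1))"]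
    by (simp only: of_bool_eq mult_zero_left)
qed

text \<open>The pointwise bound \<open>T N * W t\<close> on the squared error separates a
  coefficient tail, which tends to 0, from an integrable kernel independent of \<open>N\<close>.
  Integration gives the norm convergence.\<close>

lemma square_summable_muntz_series:
  fixes b :: "nat \<Rightarrow> complex" and g :: "real \<Rightarrow> complex"
  assumes lam: "strict_mono lam" "\<And>n. lam n > 0" "summable (\<lambda>n. 1 / real (lam n))"
    and b: "\<And>k. k \<notin> range lam \<Longrightarrow> b k = 0" "summable (\<lambda>k. (cmod (b k))\<^sup>2)"
    and g: "g \<in> borel_measurable unit_interval_measure"
    and sums: "\<And>t. 0 < t \<Longrightarrow> t < 1 \<Longrightarrow> (\<lambda>k. b k * of_real t ^ k) sums g t"
  shows "g \<in> L2_01"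
    and "(\<lambda>N. L2_norm (\<lambda>t. g t - muntz_poly b {k \<in> range lam. k < N} t)) \<longlonglongrightarrow> 0"
proof -
  define p where "p N = muntz_poly b {k \<in> range lam. k < N}" for N
  define W where "W t = (\<Sum>k. of_bool (k \<in> range lam) * t ^ (2 * k))" for t :: real
  define C where "C = (\<integral>t. W t \<partial>unit_interval_measure)"
  define T where "T N = (\<Sum>k. (cmod (b (k + N)))\<^sup>2)" for N
  have shift: "summable (\<lambda>k. (cmod (b (k + N)))\<^sup>2)" for N
    using b(2) by (rule summable_ignore_initial_segment)
  have W: "integrable unit_interval_measure W"
    unfolding W_def by (rule sparse_kernel_integrable[OF lam])
  have p_eq: "p N t = (\<Sum>k<N. b k * of_real t ^ k)" for N t
    unfolding p_def muntz_poly_def power_fun_def of_real_power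
    by (rule sum.mono_neutral_left) (use b(1) in auto)
  have pL2: "p N \<in> L2_01" for N
    unfolding p_def by (rule muntz_poly_in_L2_01)
  have p_meas: "p N \<in> borel_measurable unit_interval_measure" for N
    using pL2 by (rule L2_01_measurable)
  \<comment> \<open>The estimate is proved for the finite blocks \<open>p M t - p N t\<close> and
    passes to the limit in \<open>M\<close>.\<close>
  have bound: "(cmod (g t - p N t))\<^sup>2 \<le> T N * W t" if t: "0 < t" "t < 1" for t N
  proof (rule tendsto_upperbound)
    show "(\<lambda>M. (cmod (p M t - p N t))\<^sup>2) \<longlonglongrightarrow> (cmod (g t - p N t))\<^sup>2"
      using sums[OF t] unfolding sums_def p_eq by (intro tendsto_intros)
    have w_sum: "summable (\<lambda>k. of_bool (k \<in> range lam) * t ^ (2 * k))"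
    proof (rule summable_comparison_test'[of "\<lambda>k. t ^ k"])
      show "norm (of_bool (k \<in> range lam) * t ^ (2 * k)) \<le> t ^ k" for k
        using t power_decreasing[of k "2 * k" t] by (auto simp: of_bool_def)
    qed (use t in \<open>simp add: summable_geometric\<close>)
    have "(cmod (p M t - p N t))\<^sup>2 \<le> T N * W t" if "M \<ge> N" for M
    proof -
      have "p M t - p N t = (\<Sum>k\<in>{N..<M}. b k * of_real t ^ k)"
        unfolding p_eq using that
        by (simp add: lessThan_atLeast0 sum_diff_nat_ivl)
      then have "(cmod (p M t - p N t))\<^sup>2 \<le> (\<Sum>k\<in>{N..<M}. (cmod (b k))\<^sup>2) *
          (\<Sum>k\<in>{N..<M}. of_bool (k \<in> range lam) * t ^ (2 * k))"
        using sq_sum_sparse_le[of "range lam" b "{N..<M}" t] b(1) t by simp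
      also have "\<dots> \<le> T N * W t"
      proof (rule mult_mono)
        have "(\<Sum>k\<in>{N..<M}. (cmod (b k))\<^sup>2) = (\<Sum>k<M - N. (cmod (b (k + N)))\<^sup>2)"
          using sum.shift_bounds_nat_ivl[of "\<lambda>k. (cmod (b k))\<^sup>2" 0 N "M - N"] that
          by (simp add: lessThan_atLeast0)
        also have "\<dots> \<le> T N"
          unfolding T_def by (intro sum_le_suminf shift) auto
        finally show "(\<Sum>k\<in>{N..<M}. (cmod (b k))\<^sup>2) \<le> T N" .
        show "(\<Sum>k\<in>{N..<M}. of_bool (k \<in> range lam) * t ^ (2 * k)) \<le> W t"
          unfolding W_def using t by (intro sum_le_suminf w_sum) auto
        show "0 \<le> T N" unfolding T_def by (intro suminf_nonneg shift) auto
      qed (use t in \<open>auto intro!: sum_nonneg\<close>)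
      finally show ?thesis .
    qed
    then show "\<forall>\<^sub>F M in sequentially. (cmod (p M t - p N t))\<^sup>2 \<le> T N * W t"
      by (auto intro: eventually_sequentiallyI)
  qed simp
  have TW: "integrable unit_interval_measure (\<lambda>t. T N * W t)" for N
    using W by simp
  \<comment> \<open>Since \<open>p 0\<close> is the empty sum, the case \<open>N = 0\<close> yields
    square integrability of \<open>g\<close> itself.\<close>
  have "integrable unit_interval_measure (\<lambda>t. (cmod (g t - p 0 t))\<^sup>2)"
  proof (rule Bochner_Integration.integrable_bound[OF TW[of 0]])
    show "(\<lambda>t. (cmod (g t - p 0 t))\<^sup>2) \<in> borel_measurable unit_interval_measure"
      using g p_meas[of 0] by measurable
    show "AE t in unit_interval_measure. norm ((cmod (g t - p 0 t))\<^sup>2) \<le> norm (T 0 * W t)"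
      by (rule AE_I2) (use bound[of _ 0] in \<open>fastforce intro: order_trans[OF _ abs_ge_self]\<close>)
  qed
  then show gL2: "g \<in> L2_01"
    using g unfolding L2_01_def by (simp add: p_eq)
  have norm_le: "(L2_norm (\<lambda>t. g t - p N t))\<^sup>2 \<le> T N * C" for N
  proof -
    have "(L2_norm (\<lambda>t. g t - p N t))\<^sup>2 \<le> (\<integral>t. T N * W t \<partial>unit_interval_measure)"
      unfolding L2_norm_sq
      by (intro integral_mono L2_01_integrable L2_01_diff gL2 pL2 TW bound) auto
    then show ?thesis unfolding C_def by simp
  qed
  have "T \<longlonglongrightarrow> 0"
  proof -
    have "T = (\<lambda>N. (\<Sum>k. (cmod (b k))\<^sup>2) - (\<Sum>k<N. (cmod (b k))\<^sup>2))"
      unfolding T_def using suminf_minus_initial_segment[OF b(2)] by (rule ext)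
    moreover have "(\<lambda>N. (\<Sum>k. (cmod (b k))\<^sup>2) - (\<Sum>k<N. (cmod (b k))\<^sup>2)) \<longlonglongrightarrow>
        (\<Sum>k. (cmod (b k))\<^sup>2) - (\<Sum>k. (cmod (b k))\<^sup>2)"
      using summable_LIMSEQ[OF b(2)] by (intro tendsto_intros)
    ultimately show ?thesis by simp
  qed
  then have "(\<lambda>N. T N * C) \<longlonglongrightarrow> 0"
    by (rule tendsto_mult_left_zero)
  then have "(\<lambda>N. (L2_norm (\<lambda>t. g t - p N t))\<^sup>2) \<longlonglongrightarrow> 0"
    by (rule Lim_null_comparison[rotated]) (use norm_le in simp)
  then have "(\<lambda>N. sqrt ((L2_norm (\<lambda>t. g t - p N t))\<^sup>2)) \<longlonglongrightarrow> sqrt 0"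
    by (rule tendsto_real_sqrt)
  then show "(\<lambda>N. L2_norm (\<lambda>t. g t - muntz_poly b {k \<in> range lam. k < N} t)) \<longlonglongrightarrow> 0"
    unfolding p_def using L2_norm_nonneg by simp
qed

section \<open>From the Hardy space to the closed span\<close>

lemma hardy_imp_square_summable_coefficients:
  fixes lam :: "nat \<Rightarrow> nat"
  assumes lam: "strict_mono lam" "\<And>n. lam n > 0" "summable (\<lambda>n. 1 / real (lam n))"
    and r: "biorthogonal_family lam r"
    and f: "f \<in> hardy_H2_on (range lam)"
  shows "(\<lambda>t. f (of_real t)) \<in> L2_closed_span (M_sys lam)"
    and "summable (\<lambda>n. (cmod (L2_inner (\<lambda>t. f (of_real t)) (r n)))\<^sup>2)"
proof -
  define b where "b = fps_nth (fps_expansion f 0)"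
  define g where "g t = f (complex_of_real t)" for t
  define p where "p N = muntz_poly b {k \<in> range lam. k < N}" for N
  have b: "\<And>k. k \<notin> range lam \<Longrightarrow> b k = 0" "summable (\<lambda>k. (cmod (b k))\<^sup>2)"
    and an: "f analytic_on ball 0 1"
    using f unfolding hardy_H2_on_def hardy_H2_def b_def by auto
  have hol: "f holomorphic_on ball 0 1"
    using an by (rule analytic_imp_holomorphic)
  have "continuous_on {0<..<1} g"
    unfolding g_def
    by (rule continuous_on_compose2[OF holomorphic_on_imp_continuous_on[OF hol]])
       (auto intro!: continuous_intros)
  then have g: "g \<in> borel_measurable unit_interval_measure"
    by (intro continuous_imp_measurable_on_sets_lebesgue) auto
  have sums: "(\<lambda>k. b k * of_real t ^ k) sums g t" if "0 < t" "t < 1" for t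
    unfolding b_def g_def
    by (rule has_fps_expansion_imp_sums_complex[where r = 1])
       (use hol that in \<open>auto intro!: has_fps_expansion_fps_expansion[where A = "ball 0 1"]\<close>)
  note series = square_summable_muntz_series[OF lam b g sums]
  have gL2: "g \<in> L2_01"
    by (rule series)
  have lim: "(\<lambda>N. L2_norm (\<lambda>t. g t - p N t)) \<longlonglongrightarrow> 0"
    unfolding p_def by (rule series)
  show "(\<lambda>t. f (of_real t)) \<in> L2_closed_span (M_sys lam)"
    unfolding L2_closed_span_def g_def[symmetric]
  proof (intro CollectI conjI gL2 allI impI)
    fix \<epsilon> :: real assume "\<epsilon> > 0"
    then obtain N where "L2_norm (\<lambda>t. g t - p N t) < \<epsilon>"
      using order_tendstoD(2)[OF lim] unfolding eventually_sequentially by blast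
    moreover have "p N \<in> linear_span (M_sys lam)"
      unfolding p_def by (rule muntz_poly_in_linear_span) auto
    ultimately show "\<exists>q\<in>linear_span (M_sys lam). L2_norm (\<lambda>t. g t - q t) < \<epsilon>"
      by blast
  qed
  have coeff: "L2_inner g (r n) = b (lam n)" for n
  proof -
    have "r n \<in> L2_01"
      using r unfolding biorthogonal_family_def L2_closed_span_def by auto
    then have "(\<lambda>N. L2_inner (p N) (r n)) \<longlonglongrightarrow> L2_inner g (r n)"
      unfolding p_def by (intro L2_inner_tendsto gL2 muntz_poly_in_L2_01 lim[unfolded p_def])
    \<comment> \<open>Once \<open>N > lam n\<close>, the truncation contains the exponent
      \<open>lam n\<close>, so the inner product no longer changes.\<close>
    moreover have "\<forall>\<^sub>F N in sequentially. L2_inner (p N) (r n) = b (lam n)"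
      using eventually_gt_at_top[of "lam n"]
    proof eventually_elim
      case (elim N)
      then show ?case
        unfolding p_def by (subst L2_inner_muntz_poly_biorthogonal[OF lam(1) r]) auto
    qed
    then have "(\<lambda>N. L2_inner (p N) (r n)) \<longlonglongrightarrow> b (lam n)"
      by (rule tendsto_eventually)
    ultimately show ?thesis
      by (rule LIMSEQ_unique)
  qed
  show "summable (\<lambda>n. (cmod (L2_inner (\<lambda>t. f (of_real t)) (r n)))\<^sup>2)"
    unfolding g_def[symmetric] coeff
    using summable_mono_reindex[OF lam(1), of "\<lambda>k. (cmod (b k))\<^sup>2"] b by simp
qed

section \<open>Taylor coefficients of functions in the closed span\<close>

text \<open>The exponential bound applied to differences of approximants makes each coefficient
  sequence Cauchy. The explicit rate, geometric in \<open>k\<close>, later yields uniform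
  convergence on a small disk.\<close>

lemma closed_span_approximation:
  fixes lam :: "nat \<Rightarrow> nat"
  assumes lam: "strict_mono lam" "\<And>n. lam n > 0" "summable (\<lambda>n. 1 / real (lam n))"
    and g: "g \<in> L2_closed_span (M_sys lam)"
  obtains R F a A where "R \<ge> 1"
    "\<And>j. finite (F j)" "\<And>j. F j \<subseteq> range lam" "\<And>j k. k \<notin> F j \<Longrightarrow> a j k = 0"
    "\<And>j. L2_norm (\<lambda>t. g t - muntz_poly (a j) (F j) t) \<le> 1 / (real j + 1)"
    "\<And>k. (\<lambda>j. a j k) \<longlonglongrightarrow> A k"
    "\<And>j k. cmod (A k - a j k) \<le> 2 * R ^ k / (real j + 1)"
proof -
  obtain R where R: "R \<ge> 1"
    and bound: "\<And>F c l. finite F \<Longrightarrow> F \<subseteq> range lam \<Longrightarrow> l \<in> F \<Longrightarrow>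
       cmod (c l) \<le> R ^ l * L2_norm (muntz_poly c F)"
    using muntz_poly_coeff_exponential_bound[OF lam] by blast
  have gL2: "g \<in> L2_01" using g unfolding L2_closed_span_def by auto
  have "\<exists>F c. finite F \<and> F \<subseteq> range lam \<and> (\<forall>k. k \<notin> F \<longrightarrow> c k = 0) \<and>
      L2_norm (\<lambda>t. g t - muntz_poly c F t) \<le> 1 / (real j + 1)" for j
  proof -
    have "1 / (real j + 1) > 0" by simp
    then obtain p where p: "p \<in> linear_span (M_sys lam)" "L2_norm (\<lambda>t. g t - p t) < 1 / (real j + 1)"
      using g unfolding L2_closed_span_def by blast
    from p(1) obtain F c where "finite F" "F \<subseteq> range lam" "\<And>k. k \<notin> F \<Longrightarrow> c k = 0" "p = muntz_poly c F"
      using linear_span_muntz_polyE by blast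
    with p(2) show ?thesis by (intro exI[of _ F] exI[of _ c]) auto
  qed
  then obtain F a where F: "\<And>j. finite (F j)" "\<And>j. F j \<subseteq> range lam" "\<And>j k. k \<notin> F j \<Longrightarrow> a j k = 0"
    and approx: "\<And>j. L2_norm (\<lambda>t. g t - muntz_poly (a j) (F j) t) \<le> 1 / (real j + 1)"
    by metis
  define \<epsilon> where "\<epsilon> j = 1 / (real j + 1)" for j
  have \<epsilon>: "\<epsilon> j \<ge> 0" for j unfolding \<epsilon>_def by simp
  have \<epsilon>_lim: "\<epsilon> \<longlonglongrightarrow> 0"
    using LIMSEQ_inverse_real_of_nat unfolding \<epsilon>_def by (simp add: inverse_eq_divide add.commute)
  have diff: "cmod (a i k - a j k) \<le> R ^ k * (2 * (\<epsilon> i + \<epsilon> j))" for i j k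
  proof (cases "k \<in> range lam")
    case True
    \<comment> \<open>Both polynomials are written over one exponent set. It also contains
      \<open>k\<close>, since the coefficient bound speaks only of exponents in the set.\<close>
    define G where "G = insert k (F i \<union> F j)"
    have G: "finite G" "G \<subseteq> range lam" "k \<in> G"
      unfolding G_def using F True by auto
    have extend: "muntz_poly (a l) (F l) t = muntz_poly (a l) G t" if "F l \<subseteq> G" for l t
      unfolding muntz_poly_def by (rule sum.mono_neutral_left) (use that G F(3) in auto)
    have "muntz_poly (\<lambda>k. a i k - a j k) G =
        (\<lambda>t. (g t - muntz_poly (a j) (F j) t) - (g t - muntz_poly (a i) (F i) t))"
      by (rule ext, subst (1 2) extend) (auto simp: G_def muntz_poly_def sum_subtractf left_diff_distrib)
    then have "(L2_norm (muntz_poly (\<lambda>k. a i k - a j k) G))\<^sup>2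
        \<le> 2 * (L2_norm (\<lambda>t. g t - muntz_poly (a j) (F j) t))\<^sup>2
          + 2 * (L2_norm (\<lambda>t. g t - muntz_poly (a i) (F i) t))\<^sup>2"
      using L2_01_diff(2)[OF L2_01_diff(1)[OF gL2 muntz_poly_in_L2_01] L2_01_diff(1)[OF gL2 muntz_poly_in_L2_01]]
      by simp
    also have "\<dots> \<le> 2 * (\<epsilon> j)\<^sup>2 + 2 * (\<epsilon> i)\<^sup>2"
      using approx L2_norm_nonneg unfolding \<epsilon>_def by (intro add_mono mult_left_mono power_mono) auto
    also have "\<dots> \<le> (2 * (\<epsilon> i + \<epsilon> j))\<^sup>2"
      using \<epsilon>[of i] \<epsilon>[of j] by (simp add: power2_eq_square algebra_simps add_nonneg_nonneg)
    finally have "L2_norm (muntz_poly (\<lambda>k. a i k - a j k) G) \<le> 2 * (\<epsilon> i + \<epsilon> j)"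
      by (rule power2_le_imp_le) (use \<epsilon> in \<open>simp add: add_nonneg_nonneg\<close>)
    then have "R ^ k * L2_norm (muntz_poly (\<lambda>k. a i k - a j k) G) \<le> R ^ k * (2 * (\<epsilon> i + \<epsilon> j))"
      using R by (intro mult_left_mono) auto
    with bound[OF G, of "\<lambda>k. a i k - a j k"] show ?thesis by linarith
  next
    case False
    then have "a i k = 0" "a j k = 0" using F(2,3) by blast+
    then show ?thesis using R \<epsilon>[of i] \<epsilon>[of j] by simp
  qed
  have "\<exists>A. (\<lambda>j. a j k) \<longlonglongrightarrow> A" for k
  proof -
    have "Cauchy (\<lambda>j. a j k)"
    proof (rule metric_CauchyI)
      fix e :: real assume "e > 0"
      then have "e / (4 * R ^ k) > 0" using R by simp
      from order_tendstoD(2)[OF \<epsilon>_lim this] obtain N where N: "\<And>j. j \<ge> N \<Longrightarrow> \<epsilon> j < e / (4 * R ^ k)"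
        unfolding eventually_sequentially by blast
      show "\<exists>M. \<forall>m\<ge>M. \<forall>n\<ge>M. dist (a m k) (a n k) < e"
      proof (intro exI allI impI)
        fix m n assume "m \<ge> N" "n \<ge> N"
        then have "2 * (\<epsilon> m + \<epsilon> n) < e / R ^ k"
          using N[of m] N[of n] by simp
        then have "R ^ k * (2 * (\<epsilon> m + \<epsilon> n)) < e"
          using R by (subst (asm) pos_less_divide_eq) (auto simp: mult.commute)
        with diff[of m k n] show "dist (a m k) (a n k) < e"
          unfolding dist_norm by linarith
      qed
    qed
    then show ?thesis
      by (simp add: Cauchy_convergent_iff convergent_def)
  qed
  then obtain A where A: "\<And>k. (\<lambda>j. a j k) \<longlonglongrightarrow> A k" by metis
  have "cmod (A k - a j k) \<le> 2 * R ^ k / (real j + 1)" for j k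
  proof -
    have "(\<lambda>i. R ^ k * (2 * (\<epsilon> i + \<epsilon> j))) \<longlonglongrightarrow> R ^ k * (2 * (0 + \<epsilon> j))"
      by (intro tendsto_intros \<epsilon>_lim)
    moreover have "(\<lambda>i. cmod (a i k - a j k)) \<longlonglongrightarrow> cmod (A k - a j k)"
      by (intro tendsto_intros A)
    ultimately have "cmod (A k - a j k) \<le> R ^ k * (2 * (0 + \<epsilon> j))"
      using diff by (intro LIMSEQ_le) blast+
    then show ?thesis unfolding \<epsilon>_def by (simp add: mult_ac)
  qed
  with R F approx A show ?thesis
    by (intro that[of R F a A]) blast+
qed

text \<open>Every interval (0,d) has positive measure, so an almost everywhere vanishing function
  has zeros arbitrarily close to 0.\<close>

lemma AE_zero_near_0_imp_islimpt:
  assumes "\<rho> > 0" "AE t in lebesgue. t \<in> {0<..<\<rho>} \<longrightarrow> h t = 0"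
  shows "(0::complex) islimpt (of_real ` {t \<in> {0<..<\<rho>}. h t = 0})"
proof (rule islimptI)
  fix T :: "complex set" assume "0 \<in> T" "open T"
  then obtain e where e: "e > 0" "ball 0 e \<subseteq> T" by (meson openE)
  define d where "d = min e \<rho>"
  have d: "d > 0" unfolding d_def using e assms by simp
  have "\<exists>t\<in>{0<..<d}. h t = 0"
  proof (rule ccontr)
    assume no_zero: "\<not> ?thesis"
    from assms(2) have "AE t in lebesgue. t \<notin> {0<..<d}"
      by (rule eventually_mono) (use no_zero in \<open>auto simp: d_def\<close>)
    then have "{0<..<d} \<in> null_sets lebesgue"
      by (subst AE_iff_null_sets) auto
    then have "emeasure lebesgue {0<..<d} = 0" by (rule null_setsD1)
    with d show False by simp
  qed
  then obtain t where t: "0 < t" "t < d" "h t = 0" by auto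
  then have "complex_of_real t \<in> T"
    using e by (auto simp: d_def)
  with t show "\<exists>y\<in>of_real ` {t \<in> {0<..<\<rho>}. h t = 0}. y \<in> T \<and> y \<noteq> 0"
    by (intro bexI[of _ "complex_of_real t"]) (auto simp: d_def)
qed

text \<open>The difference is analytic near 0 and its zeros accumulate there, so the identity
  theorem makes it vanish on a disk. This turns equality modulo null sets into equality of Taylor
  coefficients.\<close>

lemma fps_expansion_eq_of_AE_eq:
  fixes f g :: "complex \<Rightarrow> complex"
  assumes f: "f has_fps_expansion \<Phi>" and g: "g has_fps_expansion \<Psi>" and "\<rho> > 0"
    and AE: "AE t in lebesgue. t \<in> {0<..<\<rho>} \<longrightarrow> f (of_real t) - g (of_real t) = 0"
  shows "\<Phi> = \<Psi>"
proof -
  define h where "h z = f z - g z" for z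
  have h: "h has_fps_expansion (\<Phi> - \<Psi>)"
    unfolding h_def by (intro fps_expansion_intros f g)
  then have "h analytic_on {0}"
    by (rule has_fps_expansion_imp_analytic_0)
  then obtain s where s: "s > 0" "h holomorphic_on ball 0 s"
    unfolding analytic_on_def by auto
  define \<sigma> where "\<sigma> = min s \<rho>"
  have \<sigma>: "\<sigma> > 0" unfolding \<sigma>_def using s assms by simp
  let ?U = "of_real ` {t \<in> {0<..<\<sigma>}. h (of_real t) = 0} :: complex set"
  have "0 islimpt ?U"
    by (rule AE_zero_near_0_imp_islimpt[OF \<sigma>])
       (use AE in \<open>auto simp: h_def \<sigma>_def elim: eventually_mono\<close>)
  have "h z = 0" if "z \<in> ball 0 s" for z
    by (rule analytic_continuation[OF s(2), of ?U 0])
       (use \<open>0 islimpt ?U\<close> that s in \<open>auto simp: \<sigma>_def\<close>)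
  then have "\<forall>\<^sub>F z in nhds 0. h z = 0"
    using s(1) by (intro eventually_nhds_in_open[THEN eventually_mono, of "ball 0 s"]) auto
  then have "h has_fps_expansion 0"
    by (simp add: has_fps_expansion_0_iff)
  then have "\<Phi> - \<Psi> = 0"
    using h fps_expansion_unique_complex by blast
  then show ?thesis by simp
qed

text \<open>The approximants tend to \<open>f\<close> in the norm of \<open>L2_01\<close> and
  uniformly to the power series \<open>G\<close> on a small disk. Hence \<open>f\<close> and
  \<open>G\<close> agree almost everywhere near 0 on the positive axis, and their coefficients
  coincide.\<close>

lemma taylor_coefficients_of_closed_span:
  fixes lam :: "nat \<Rightarrow> nat"
  assumes lam: "strict_mono lam" "\<And>n. lam n > 0" "summable (\<lambda>n. 1 / real (lam n))"
    and r: "biorthogonal_family lam r"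
    and f: "f analytic_on ball 0 1"
    and span: "(\<lambda>t. f (of_real t)) \<in> L2_closed_span (M_sys lam)"
  shows "k \<notin> range lam \<Longrightarrow> fps_nth (fps_expansion f 0) k = 0"
    and "fps_nth (fps_expansion f 0) (lam n) = L2_inner (\<lambda>t. f (of_real t)) (r n)"
proof -
  define g where "g t = f (complex_of_real t)" for t
  have g: "g \<in> L2_closed_span (M_sys lam)"
    using span unfolding g_def .
  then have gL2: "g \<in> L2_01" unfolding L2_closed_span_def by auto
  obtain R F a A where R: "R \<ge> 1"
    and F: "\<And>j. finite (F j)" "\<And>j. F j \<subseteq> range lam" "\<And>j k. k \<notin> F j \<Longrightarrow> a j k = 0"
    and approx: "\<And>j. L2_norm (\<lambda>t. g t - muntz_poly (a j) (F j) t) \<le> 1 / (real j + 1)"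
    and A: "\<And>k. (\<lambda>j. a j k) \<longlonglongrightarrow> A k"
    and A_diff: "\<And>j k. cmod (A k - a j k) \<le> 2 * R ^ k / (real j + 1)"
    using closed_span_approximation[OF lam g] by blast
  define p where "p j = muntz_poly (a j) (F j)" for j
  \<comment> \<open>With this radius \<open>R * \<rho> = 1 / 2\<close>, so the coefficient errors
    sum to a geometric series with total \<open>4 / (real j + 1)\<close>.\<close>
  define \<rho> where "\<rho> = 1 / (2 * R)"
  have \<rho>: "0 < \<rho>" "\<rho> < 1" unfolding \<rho>_def using R by (auto simp: field_simps)
  define G where "G z = (\<Sum>k. A k * z ^ k)" for z :: complex
  have a_sums: "(\<lambda>k. a j k * z ^ k) sums (\<Sum>k\<in>F j. a j k * z ^ k)" for j and z :: complex
    by (rule sums_finite) (use F in auto)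
  have term_le: "norm ((A k - a j k) * z ^ k) \<le> 2 / (real j + 1) * (1 / 2) ^ k"
    if "cmod z < \<rho>" for j k z
  proof -
    have "norm ((A k - a j k) * z ^ k) \<le> 2 * R ^ k / (real j + 1) * \<rho> ^ k"
      unfolding norm_mult norm_power using that R
      by (intro mult_mono A_diff power_mono) auto
    also have "\<dots> = 2 / (real j + 1) * (R * \<rho>) ^ k"
      by (simp add: power_mult_distrib)
    also have "R * \<rho> = 1 / 2" unfolding \<rho>_def using R by simp
    finally show ?thesis .
  qed
  have geom: "summable (\<lambda>k. c * (1 / 2 :: real) ^ k)" "(\<Sum>k. c * (1 / 2 :: real) ^ k) = 2 * c" for c
    using sums_mult[OF geometric_sums[of "1 / 2 :: real"], of c] by (auto simp: sums_iff)
  have diff_summable: "summable (\<lambda>k. (A k - a j k) * z ^ k)" if "cmod z < \<rho>" for j z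
    by (rule summable_comparison_test'[OF geom(1)]) (rule term_le[OF that])
  \<comment> \<open>Convergence follows by adding the finite polynomial with index 0 to the
    absolutely convergent series of differences.\<close>
  have G_sums: "(\<lambda>k. A k * z ^ k) sums G z" if "cmod z < \<rho>" for z
    unfolding G_def
    using summable_add[OF diff_summable[OF that, of 0] sums_summable[OF a_sums[of 0 z]]]
    by (simp add: algebra_simps summable_sums)
  have G_diff: "cmod (G z - (\<Sum>k\<in>F j. a j k * z ^ k)) \<le> 4 / (real j + 1)" if "cmod z < \<rho>" for j z
  proof -
    have "(\<lambda>k. (A k - a j k) * z ^ k) sums (G z - (\<Sum>k\<in>F j. a j k * z ^ k))"
      using sums_diff[OF G_sums[OF that] a_sums[of j z]] by (simp add: algebra_simps)
    then have "cmod (G z - (\<Sum>k\<in>F j. a j k * z ^ k)) = cmod (\<Sum>k. (A k - a j k) * z ^ k)"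
      by (simp add: sums_iff)
    also have "\<dots> \<le> (\<Sum>k. 2 / (real j + 1) * (1 / 2) ^ k)"
      by (rule norm_suminf_le[OF term_le[OF that] geom(1)])
    finally show ?thesis unfolding geom by simp
  qed
  have G_exp: "G has_fps_expansion Abs_fps A"
  proof (rule has_fps_expansionI)
    have "\<forall>\<^sub>F z in nhds (0::complex). z \<in> ball 0 \<rho>"
      using \<rho> by (intro eventually_nhds_in_open) auto
    then show "\<forall>\<^sub>F z in nhds 0. (\<lambda>k. fps_nth (Abs_fps A) k * z ^ k) sums G z"
      by eventually_elim (use G_sums in auto)
  qed
  have f_exp: "f has_fps_expansion fps_expansion f 0"
    by (rule has_fps_expansion_fps_expansion[of "ball 0 1"])
       (use f in \<open>auto intro: analytic_imp_holomorphic\<close>)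
  \<comment> \<open>The indicator restricts the comparison to the range where the series for
    \<open>G\<close> is controlled; beyond \<rho> the value of \<open>G\<close> may be
    meaningless.\<close>
  define \<phi> where "\<phi> t = indicator {0<..<\<rho>} t * (cmod (g t - G (of_real t)))\<^sup>2" for t :: real
  have "(\<lambda>t. G (complex_of_real t)) \<in> borel_measurable unit_interval_measure"
    unfolding G_def
    by (intro borel_measurable_suminf continuous_imp_measurable_on_sets_lebesgue continuous_intros) auto
  moreover have "(indicator {0<..<\<rho>} :: real \<Rightarrow> real) \<in> borel_measurable unit_interval_measure"
    by (intro measurable_restrict_space1 borel_measurable_indicator) auto
  ultimately have \<phi>_meas: "\<phi> \<in> borel_measurable unit_interval_measure"
    unfolding \<phi>_def using L2_01_measurable[OF gL2] by measurable
  \<comment> \<open>The squared error splits into the norm error of \<open>p j\<close> and its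
    uniform distance to \<open>G\<close>. The integral is at most
    \<open>(2 * 1 + 2 * 16) / (real j + 1)\<^sup>2\<close>, whence the constant 34 below.\<close>
  define B where "B j t = 2 * (cmod (g t - p j t))\<^sup>2 + 2 * (4 / (real j + 1))\<^sup>2" for j t
  have pL2: "(\<lambda>t. g t - p j t) \<in> L2_01" for j
    unfolding p_def by (intro L2_01_diff gL2 muntz_poly_in_L2_01)
  have const: "integrable unit_interval_measure (\<lambda>t. c)" "(\<integral>t. c \<partial>unit_interval_measure) = c" for c :: real
    using integral_unit_interval_power[of 0] by (auto intro!: integrable_unit_interval)
  have B_int: "integrable unit_interval_measure (B j)" for j
    unfolding B_def
    by (intro Bochner_Integration.integrable_add integrable_mult_right L2_01_integrable pL2 const)
  have B_le: "(\<integral>t. B j t \<partial>unit_interval_measure) \<le> 34 / (real j + 1)\<^sup>2" for j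
  proof -
    have "(\<integral>t. B j t \<partial>unit_interval_measure) = 2 * (L2_norm (\<lambda>t. g t - p j t))\<^sup>2 + 2 * (4 / (real j + 1))\<^sup>2"
      unfolding B_def L2_norm_sq using L2_01_integrable[OF pL2[of j]] const(1) const(2)[of 1] by simp
    also have "\<dots> \<le> 2 * (1 / (real j + 1))\<^sup>2 + 2 * (4 / (real j + 1))\<^sup>2"
      using approx[of j] unfolding p_def
      by (intro add_right_mono mult_left_mono power_mono L2_norm_nonneg) auto
    finally show ?thesis by (simp add: power_divide)
  qed
  have \<phi>_le: "\<phi> t \<le> B j t" for j t
  proof (cases "t \<in> {0<..<\<rho>}")
    case True
    have "p j t = (\<Sum>k\<in>F j. a j k * of_real t ^ k)"
      unfolding p_def muntz_poly_def power_fun_def by simp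
    then have "(cmod (G (of_real t) - p j t))\<^sup>2 \<le> (4 / (real j + 1))\<^sup>2"
      using G_diff[of "of_real t" j] True by (intro power_mono) auto
    moreover have "\<phi> t = (cmod ((g t - p j t) - (G (of_real t) - p j t)))\<^sup>2"
      using True by (simp add: \<phi>_def)
    ultimately show ?thesis
      using cmod_diff_sq_le[of "g t - p j t" "G (of_real t) - p j t"]
      unfolding B_def by linarith
  qed (simp add: \<phi>_def B_def)
  have \<phi>_nonneg: "\<phi> t \<ge> 0" for t unfolding \<phi>_def by simp
  have \<phi>_int: "integrable unit_interval_measure \<phi>"
    by (rule Bochner_Integration.integrable_bound[OF B_int[of 0] \<phi>_meas])
       (use \<phi>_le[of _ 0] \<phi>_nonneg in \<open>auto intro!: AE_I2 simp: abs_of_nonneg intro: order_trans[OF _ abs_ge_self]\<close>)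
  have "(\<integral>t. \<phi> t \<partial>unit_interval_measure) \<le> 34 / (real j + 1)\<^sup>2" for j
    using integral_mono[OF \<phi>_int B_int \<phi>_le, of j] B_le[of j] by linarith
  moreover have "(\<lambda>j. 34 / (real j + 1)\<^sup>2) \<longlonglongrightarrow> 0"
    by real_asymp
  ultimately have "(\<integral>t. \<phi> t \<partial>unit_interval_measure) \<le> 0"
    by (intro LIMSEQ_le_const) auto
  then have "(\<integral>t. \<phi> t \<partial>unit_interval_measure) = 0"
    using integral_nonneg_AE[of \<phi> unit_interval_measure] \<phi>_nonneg by (auto intro: order_antisym)
  then have "AE t in unit_interval_measure. \<phi> t = 0"
    using integral_nonneg_eq_0_iff_AE[OF \<phi>_int] \<phi>_nonneg by auto
  then have "AE t in lebesgue. t \<in> {0<..<1} \<longrightarrow> \<phi> t = 0"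
    by (subst (asm) AE_restrict_space_iff) auto
  then have "AE t in lebesgue. t \<in> {0<..<\<rho>} \<longrightarrow> f (of_real t) - G (of_real t) = 0"
    by (rule eventually_mono) (use \<rho> in \<open>auto simp: \<phi>_def g_def\<close>)
  then have "fps_expansion f 0 = Abs_fps A"
    by (rule fps_expansion_eq_of_AE_eq[OF f_exp G_exp \<rho>(1)])
  then have coeff: "fps_nth (fps_expansion f 0) k = A k" for k by simp
  show "fps_nth (fps_expansion f 0) k = 0" if "k \<notin> range lam" for k
  proof -
    have "(\<lambda>j. a j k) = (\<lambda>j. 0)" using F(2,3) that by blast
    then have "(\<lambda>j. 0) \<longlonglongrightarrow> A k" using A[of k] by simp
    then show ?thesis unfolding coeff by (simp add: LIMSEQ_const_iff)
  qed
  show "fps_nth (fps_expansion f 0) (lam n) = L2_inner (\<lambda>t. f (of_real t)) (r n)"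
  proof -
    have "r n \<in> L2_01"
      using r unfolding biorthogonal_family_def L2_closed_span_def by auto
    moreover have "(\<lambda>j. L2_norm (\<lambda>t. g t - p j t)) \<longlonglongrightarrow> 0"
    proof (rule tendsto_sandwich[OF _ _ tendsto_const])
      show "\<forall>\<^sub>F j in sequentially. 0 \<le> L2_norm (\<lambda>t. g t - p j t)"
        by (intro always_eventually allI L2_norm_nonneg)
      show "\<forall>\<^sub>F j in sequentially. L2_norm (\<lambda>t. g t - p j t) \<le> 1 / (real j + 1)"
        unfolding p_def by (intro always_eventually allI approx)
      show "(\<lambda>j. 1 / (real j + 1)) \<longlonglongrightarrow> 0" by real_asymp
    qed
    ultimately have "(\<lambda>j. L2_inner (p j) (r n)) \<longlonglongrightarrow> L2_inner g (r n)"
      by (intro L2_inner_tendsto gL2) (auto simp: p_def muntz_poly_in_L2_01)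
    moreover have "L2_inner (p j) (r n) = a j (lam n)" for j
      unfolding p_def using L2_inner_muntz_poly_biorthogonal[OF lam(1) r F(1,2)] F(3) by simp
    ultimately have "(\<lambda>j. a j (lam n)) \<longlonglongrightarrow> L2_inner g (r n)" by simp
    then show ?thesis
      unfolding coeff g_def using A LIMSEQ_unique by blast
  qed
qed

theorem theorem1p3:
  fixes lam :: "nat \<Rightarrow> nat"
    and r :: "nat \<Rightarrow> real \<Rightarrow> complex"
    and f :: "complex \<Rightarrow> complex"
  assumes "strict_mono lam"
    and "\<And>n. lam n > 0"
    and "summable (\<lambda>n. 1 / real (lam n))"
    and "(INF n. real (lam (Suc n)) - real (lam n)) > 0"
    and "biorthogonal_family lam r"
    and "f analytic_on ball 0 1"
  shows "f \<in> hardy_H2_on (range lam) \<longleftrightarrow>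
           (\<lambda>t. f (complex_of_real t)) \<in> L2_closed_span (M_sys lam) \<and>
           summable (\<lambda>n. (cmod (L2_inner (\<lambda>t. f (complex_of_real t)) (r n)))\<^sup>2)"
proof
  assume "f \<in> hardy_H2_on (range lam)"
  then show "(\<lambda>t. f (complex_of_real t)) \<in> L2_closed_span (M_sys lam) \<and>
      summable (\<lambda>n. (cmod (L2_inner (\<lambda>t. f (complex_of_real t)) (r n)))\<^sup>2)"
    using hardy_imp_square_summable_coefficients[OF assms(1-3,5)] by blast
next
  assume "(\<lambda>t. f (complex_of_real t)) \<in> L2_closed_span (M_sys lam) \<and>
      summable (\<lambda>n. (cmod (L2_inner (\<lambda>t. f (complex_of_real t)) (r n)))\<^sup>2)"
  then have span: "(\<lambda>t. f (complex_of_real t)) \<in> L2_closed_span (M_sys lam)"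
    and summ: "summable (\<lambda>n. (cmod (L2_inner (\<lambda>t. f (complex_of_real t)) (r n)))\<^sup>2)"
    by auto
  note taylor = taylor_coefficients_of_closed_span[OF assms(1-3,5,6) span]
  \<comment> \<open>Coefficients off \<open>range lam\<close> vanish and the others are the inner
    products with \<open>r n\<close>, so reindexing along \<open>lam\<close> transfers
    summability.\<close>
  have "summable (\<lambda>k. (cmod (fps_nth (fps_expansion f 0) k))\<^sup>2)"
    using summable_mono_reindex[OF assms(1), of "\<lambda>k. (cmod (fps_nth (fps_expansion f 0) k))\<^sup>2"]
      taylor summ by simp
  then show "f \<in> hardy_H2_on (range lam)"
    unfolding hardy_H2_on_def hardy_H2_def using assms(6) taylor(1) by blast
qed

end
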